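(* Fix $h\in\{f,g\}$ and suppose that the bound $C_t^{(h)}<\infty$ holds for the times $t\ge 1$ under consideration. Suppose the tensor-train approximations $\hat\pi_t$ produced by the recursive algorithm satisfy $\|\hat\pi_t-q_t\|_{L^1}\le\epsilon_t$ at every time $t\geq 1$. Then for every $t>0$ the total error satisfies $$\|\hat\pi_t-\pi_t\|_{L^1}\;\le\; C_t^{(h)}\,\|\pi_{t-1}-\hat\pi_{t-1}\|_{L^1}+\epsilon_t\;\le\;\sum_{k=1}^{t}C^{\,t-k}\epsilon_k,\qquad C=\sup_t C_t^{(h)}.$$
   Context: State-space model. $\mathcal X\subseteq\mathbb R^m$ (states), $\mathcal Y\subseteq\mathbb R^n$ (data) and $\Theta\subseteq\mathbb R^d$ (parameters) are Cartesian products; all densities are with respect to Lebesgue measure. $p(\theta)$ and $p(x_0|\theta)$ are prior probability densities on $\Theta$ and $\mathcal X$; $f(x_t|x_{t-1},\theta)$ is a transition probability density in $x_t\in\mathcal X$ for each $(x_{t-1},\theta)$; $g(y_t|x_t,\theta)\ge 0$ is the likelihood. The data $y_1,y_2,\ldots$ are fixed. Exact unnormalized posterior densities: $\pi_1(x_1,\theta,x_0)=p(\theta)p(x_0|\theta)f(x_1|x_0,\theta)g(y_1|x_1,\theta)$ and, for $t\ge2$, $$\pi_t(x_t,\theta,x_{t-1})=\pi(x_{t-1},\theta|y_{1:t-1})\,f(x_t|x_{t-1},\theta)\,g(y_t|x_t,\theta),\qquad \pi(x_{t-1},\theta|y_{1:t-1})=\int\pi_{t-1}(x_{t-1},\theta,x_{t-2})\,dx_{t-2}.$$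 Recursive approximation algorithm. At time $t\ge1$ define $$q_t(x_t,\theta,x_{t-1})=\hat\pi(x_{t-1},\theta|y_{1:t-1})\,f(x_t|x_{t-1},\theta)\,g(y_t|x_t,\theta),$$ where for $t\ge2$, $\hat\pi(x_{t-1},\theta|y_{1:t-1})=\int\hat\pi_{t-1}(x_{t-1},\theta,x_{t-2})\,dx_{t-2}$ is the marginal of the previous approximation, and for $t=1$ it is the exact prior $p(\theta)p(x_0|\theta)$. No approximation is made at time $0$: $\hat\pi_0=\pi_0$ and $\|\hat\pi_0-\pi_0\|_{L^1}=0$. Then $q_t$ is approximated by an integrable real-valued (possibly negative somewhere) function $\hat\pi_t(x_t,\theta,x_{t-1})$ in tensor-train form, i.e. a product of $2m+d$ matrix-valued functions (of compatible finite sizes, first with one row, last with one column), each depending on a single scalar coordinate of $(x_t,\theta,x_{t-1})$. Constants: $$C_t^{(g)}=\sup_{x_t\in\mathcal X,\theta\in\Theta}g(y_t|x_t,\theta),\qquad C_t^{(f)}=\sup_{x_{t-1}\in\mathcal X,\theta\in\Theta}\int f(x_t|x_{t-1},\theta)\,g(y_t|x_t,\theta)\,dx_t.$$ $L^1$ norms are over $\mathcal X\times\Theta\times\mathcal X$ with Lebesgue measure. *)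

theory Defs
  imports "HOL-Analysis.Analysis" "Jordan_Normal_Form.Matrix"
begin

section \<open>State-space models\<close>

text \<open>The argument order of the conditional densities follows the usual notation:
  \<open>init_dens M x \<theta>\<close> is $p(x_0 = x \mid \theta)$, \<open>trans_dens M x x' \<theta>\<close> is $f(x \mid x', \theta)$, with
  \<open>x'\<close> the previous state, and \<open>likelihood M y x \<theta>\<close> is $g(y \mid x, \theta)$.\<close>

record ('x, 'p, 'o) ssm =
  state_set :: "'x set"
  param_set :: "'p set"
  data_set :: "'o set"
  param_prior :: "'p \<Rightarrow> real"
  init_dens :: "'x \<Rightarrow> 'p \<Rightarrow> real"
  trans_dens :: "'x \<Rightarrow> 'x \<Rightarrow> 'p \<Rightarrow> real"
  likelihood :: "'o \<Rightarrow> 'x \<Rightarrow> 'p \<Rightarrow> real"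

definition cartesian_product :: "(real ^ 'k) set \<Rightarrow> bool" where
  "cartesian_product S \<longleftrightarrow>
     (\<exists>A :: 'k \<Rightarrow> real set. (\<forall>i. A i \<in> sets borel) \<and> S = {x. \<forall>i. vec_nth x i \<in> A i})"

definition prob_density_on :: "'a::euclidean_space set \<Rightarrow> ('a \<Rightarrow> real) \<Rightarrow> bool" where
  "prob_density_on S h \<longleftrightarrow>
     set_borel_measurable lborel S h \<and> (\<forall>x\<in>S. 0 \<le> h x) \<and>
     (\<integral>\<^sup>+x\<in>S. ennreal (h x) \<partial>lborel) = 1"

definition state_space_model :: "(real ^ 'm, real ^ 'd, real ^ 'n) ssm \<Rightarrow> bool" where
  "state_space_model M \<longleftrightarrow>
     cartesian_product (state_set M) \<and>
     cartesian_product (param_set M) \<and>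
     cartesian_product (data_set M) \<and>
     prob_density_on (param_set M) (param_prior M) \<and>
     set_borel_measurable lborel (state_set M \<times> param_set M) (\<lambda>(x, \<theta>). init_dens M x \<theta>) \<and>
     (\<forall>\<theta>\<in>param_set M. prob_density_on (state_set M) (\<lambda>x. init_dens M x \<theta>)) \<and>
     set_borel_measurable lborel (state_set M \<times> state_set M \<times> param_set M)
       (\<lambda>(x, x', \<theta>). trans_dens M x x' \<theta>) \<and>
     (\<forall>x'\<in>state_set M. \<forall>\<theta>\<in>param_set M.
        prob_density_on (state_set M) (\<lambda>x. trans_dens M x x' \<theta>)) \<and>
     (\<forall>y\<in>data_set M.
        set_borel_measurable lborel (state_set M \<times> param_set M) (\<lambda>(x, \<theta>). likelihood M y x \<theta>) \<and>
        (\<forall>x\<in>state_set M. \<forall>\<theta>\<in>param_set M. 0 \<le> likelihood M y x \<theta>))"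


section \<open>Exact and approximate recursions\<close>

text \<open>Joint densities at a time \<open>t \<ge> 1\<close> are functions of the triple
  $(x_t, \theta, x_{t-1})$; marginals are functions of the pair $(x_t, \theta)$.\<close>

definition joint_set :: "('x, 'p, 'o) ssm \<Rightarrow> ('x \<times> 'p \<times> 'x) set" where
  "joint_set M = state_set M \<times> param_set M \<times> state_set M"

definition prior :: "('x, 'p, 'o) ssm \<Rightarrow> 'x \<times> 'p \<Rightarrow> real" where
  "prior M = (\<lambda>(x, \<theta>). param_prior M \<theta> * init_dens M x \<theta>)"

definition propagate ::
  "('x, 'p, 'o) ssm \<Rightarrow> 'o \<Rightarrow> ('x \<times> 'p \<Rightarrow> real) \<Rightarrow> 'x \<times> 'p \<times> 'x \<Rightarrow> real" where
  "propagate M y \<mu> = (\<lambda>(x, \<theta>, x'). \<mu> (x', \<theta>) * trans_dens M x x' \<theta> * likelihood M y x \<theta>)"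

definition marginal ::
  "('x::euclidean_space, 'p, 'o) ssm \<Rightarrow> ('x \<times> 'p \<times> 'x \<Rightarrow> real) \<Rightarrow> 'x \<times> 'p \<Rightarrow> real" where
  "marginal M F = (\<lambda>(x, \<theta>). LINT x':state_set M|lborel. F (x, \<theta>, x'))"

text \<open>\<open>exact_marginal M y t\<close> is $\pi(x_t, \theta \mid y_{1:t})$, the marginal of $\pi_t$, and the prior
  for \<open>t = 0\<close>.\<close>

primrec exact_marginal ::
  "('x::euclidean_space, 'p, 'o) ssm \<Rightarrow> (nat \<Rightarrow> 'o) \<Rightarrow> nat \<Rightarrow> 'x \<times> 'p \<Rightarrow> real" where
  "exact_marginal M y 0 = prior M"
| "exact_marginal M y (Suc t) = marginal M (propagate M (y (Suc t)) (exact_marginal M y t))"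

definition exact_post ::
  "('x::euclidean_space, 'p, 'o) ssm \<Rightarrow> (nat \<Rightarrow> 'o) \<Rightarrow> nat \<Rightarrow> 'x \<times> 'p \<times> 'x \<Rightarrow> real" where
  "exact_post M y t = propagate M (y t) (exact_marginal M y (t - 1))"

definition approx_marginal ::
  "('x::euclidean_space, 'p, 'o) ssm \<Rightarrow> (nat \<Rightarrow> 'x \<times> 'p \<times> 'x \<Rightarrow> real) \<Rightarrow> nat \<Rightarrow> 'x \<times> 'p \<Rightarrow> real" where
  "approx_marginal M \<pi>hat t = (if t = 0 then prior M else marginal M (\<pi>hat t))"

text \<open>\<open>approx_target\<close> is $q_t$, the function that is replaced by \<open>\<pi>hat t\<close>.\<close>

definition approx_target ::
  "('x::euclidean_space, 'p, 'o) ssm \<Rightarrow> (nat \<Rightarrow> 'o) \<Rightarrow> (nat \<Rightarrow> 'x \<times> 'p \<times> 'x \<Rightarrow> real) \<Rightarrow>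
    nat \<Rightarrow> 'x \<times> 'p \<times> 'x \<Rightarrow> real" where
  "approx_target M y \<pi>hat t = propagate M (y t) (approx_marginal M \<pi>hat (t - 1))"


section \<open>Norms and constants\<close>

definition L1_dist :: "'a::euclidean_space set \<Rightarrow> ('a \<Rightarrow> real) \<Rightarrow> ('a \<Rightarrow> real) \<Rightarrow> ennreal" where
  "L1_dist S F G = (\<integral>\<^sup>+z\<in>S. ennreal \<bar>F z - G z\<bar> \<partial>lborel)"

text \<open>At time \<open>0\<close> there is no previous state, so $\pi_0$ and $\hat\pi_0$ are functions of
  $(x_0, \theta)$ only; both are the prior.\<close>

definition total_error ::
  "('x::euclidean_space, 'p::euclidean_space, 'o) ssm \<Rightarrow> (nat \<Rightarrow> 'o) \<Rightarrow>
    (nat \<Rightarrow> 'x \<times> 'p \<times> 'x \<Rightarrow> real) \<Rightarrow> nat \<Rightarrow> ennreal" where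
  "total_error M y \<pi>hat t =
     (if t = 0
      then L1_dist (state_set M \<times> param_set M) (approx_marginal M \<pi>hat 0) (exact_marginal M y 0)
      else L1_dist (joint_set M) (\<pi>hat t) (exact_post M y t))"

definition Cg :: "('x, 'p, 'o) ssm \<Rightarrow> (nat \<Rightarrow> 'o) \<Rightarrow> nat \<Rightarrow> ennreal" where
  "Cg M y t = (SUP (x, \<theta>)\<in>state_set M \<times> param_set M. ennreal (likelihood M (y t) x \<theta>))"

definition Cf :: "('x::euclidean_space, 'p, 'o) ssm \<Rightarrow> (nat \<Rightarrow> 'o) \<Rightarrow> nat \<Rightarrow> ennreal" where
  "Cf M y t = (SUP (x', \<theta>)\<in>state_set M \<times> param_set M.
     \<integral>\<^sup>+x\<in>state_set M. ennreal (trans_dens M x x' \<theta> * likelihood M (y t) x \<theta>) \<partial>lborel)"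


section \<open>Tensor trains\<close>

text \<open>The order on the index type fixes the order of the scalar coordinates.\<close>

definition coords :: "real ^ 'k::{finite,wellorder} \<Rightarrow> real list" where
  "coords x = map (vec_nth x) (sorted_list_of_set UNIV)"

definition joint_coords ::
  "(real ^ 'm::{finite,wellorder}) \<times> (real ^ 'd::{finite,wellorder}) \<times> (real ^ 'm::{finite,wellorder}) \<Rightarrow> real list" where
  "joint_coords = (\<lambda>(x, \<theta>, x'). coords x @ coords \<theta> @ coords x')"

text \<open>The \<open>k\<close>-th core \<open>G k\<close> maps the \<open>k\<close>-th scalar coordinate to an \<open>r k \<times> r (k + 1)\<close> matrix.
  The product of all cores is a \<open>1 \<times> 1\<close> matrix, identified with its entry.\<close>

definition tensor_train_on ::
  "((real ^ 'm::{finite,wellorder}) \<times> (real ^ 'd::{finite,wellorder}) \<times> (real ^ 'm::{finite,wellorder})) set \<Rightarrow>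
    ((real ^ 'm::{finite,wellorder}) \<times> (real ^ 'd::{finite,wellorder}) \<times> (real ^ 'm::{finite,wellorder}) \<Rightarrow> real) \<Rightarrow> bool" where
  "tensor_train_on S F \<longleftrightarrow>
     (let N = 2 * CARD('m) + CARD('d) in
      \<exists>(r :: nat \<Rightarrow> nat) (G :: nat \<Rightarrow> real \<Rightarrow> real mat).
        r 0 = 1 \<and> r N = 1 \<and> (\<forall>k\<le>N. 0 < r k) \<and>
        (\<forall>k<N. \<forall>s. G k s \<in> carrier_mat (r k) (r (k + 1))) \<and>
        (\<forall>z\<in>S. F z = foldr (*) (map (\<lambda>k. G k (joint_coords z ! k)) [0..<N]) (1\<^sub>m 1) $$ (0, 0)))"

end

theory Submission
  imports Defs
begin

text \<open>Integrating out the old state contracts the $L^1$ distance, and by Tonelli the map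
  \<open>propagate\<close> expands it by at most $\sup \int f g \, dx_t$. This supremum is $C_t^{(f)}$, and it is
  at most $C_t^{(g)}$ because \<open>f\<close> is a probability density. The triangle inequality through
  $q_t$ gives the one-step bound, which is then iterated from the zero error at time \<open>0\<close>.\<close>

section \<open>Tonelli and regrouping of triples under Lebesgue measure\<close>

lemma nn_integral_lborel_fst:
  fixes f :: "'a::euclidean_space \<times> 'b::euclidean_space \<Rightarrow> ennreal"
  assumes "f \<in> borel_measurable borel"
  shows "(\<integral>\<^sup>+z. f z \<partial>lborel) = (\<integral>\<^sup>+x. \<integral>\<^sup>+y. f (x, y) \<partial>lborel \<partial>lborel)"
  using lborel.nn_integral_fst[of f lborel] assms by (simp add: lborel_prod)

lemma nn_integral_lborel_snd:
  fixes f :: "'a::euclidean_space \<times> 'b::euclidean_space \<Rightarrow> ennreal"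
  assumes "f \<in> borel_measurable borel"
  shows "(\<integral>\<^sup>+z. f z \<partial>lborel) = (\<integral>\<^sup>+y. \<integral>\<^sup>+x. f (x, y) \<partial>lborel \<partial>lborel)"
  using lborel_pair.nn_integral_snd[of f] assms by (simp add: lborel_prod)

text \<open>Joint densities live on triples grouped as (x, (\<theta>, x')), whereas integrating out
  x' needs the grouping ((x, \<theta>), x'). By Tonelli both sides unfold to the same threefold
  iterated integral.\<close>

lemma nn_integral_lborel_assoc:
  fixes f :: "'a::euclidean_space \<times> 'b::euclidean_space \<times> 'c::euclidean_space \<Rightarrow> ennreal"
  assumes [measurable]: "f \<in> borel_measurable borel"
  shows "(\<integral>\<^sup>+z. f (fst (fst z), snd (fst z), snd z) \<partial>lborel) = (\<integral>\<^sup>+z. f z \<partial>lborel)"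
proof -
  have [measurable]: "f \<in> borel_measurable (borel \<Otimes>\<^sub>M borel \<Otimes>\<^sub>M borel)"
    by (simp add: borel_prod)
  have "(\<lambda>z::('a \<times> 'b) \<times> 'c. f (fst (fst z), snd (fst z), snd z))
          \<in> borel_measurable ((borel \<Otimes>\<^sub>M borel) \<Otimes>\<^sub>M borel)"
    by measurable
  hence 1: "(\<lambda>z::('a \<times> 'b) \<times> 'c. f (fst (fst z), snd (fst z), snd z)) \<in> borel_measurable borel"
    by (simp add: borel_prod)
  have "(\<lambda>z::'a \<times> 'b. \<integral>\<^sup>+c. f (fst z, snd z, c) \<partial>lborel) \<in> borel_measurable (borel \<Otimes>\<^sub>M borel)"
    by measurable
  hence 2: "(\<lambda>z::'a \<times> 'b. \<integral>\<^sup>+c. f (fst z, snd z, c) \<partial>lborel) \<in> borel_measurable borel"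
    by (simp add: borel_prod)
  have 3: "(\<lambda>z. f (a, z)) \<in> borel_measurable borel" for a
  proof -
    have "(\<lambda>z. f (a, z)) \<in> borel_measurable (borel \<Otimes>\<^sub>M borel)"
      by measurable
    thus ?thesis
      by (simp add: borel_prod)
  qed
  show ?thesis
    by (simp add: nn_integral_lborel_fst[OF 1] nn_integral_lborel_fst[OF 2]
        nn_integral_lborel_fst[OF assms] nn_integral_lborel_fst[OF 3])
qed

lemma integrable_lborel_assoc:
  fixes f :: "'a::euclidean_space \<times> 'b::euclidean_space \<times> 'c::euclidean_space \<Rightarrow> real"
  assumes "integrable lborel f"
  shows "integrable lborel (\<lambda>z. f (fst (fst z), snd (fst z), snd z))"
proof (rule integrableI_bounded)
  have f: "f \<in> borel_measurable borel"
    using borel_measurable_integrable[OF assms] by simp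
  hence [measurable]: "f \<in> borel_measurable (borel \<Otimes>\<^sub>M borel \<Otimes>\<^sub>M borel)"
    by (simp add: borel_prod)
  have "(\<lambda>z::('a \<times> 'b) \<times> 'c. f (fst (fst z), snd (fst z), snd z))
          \<in> borel_measurable ((borel \<Otimes>\<^sub>M borel) \<Otimes>\<^sub>M borel)"
    by measurable
  thus "(\<lambda>z::('a \<times> 'b) \<times> 'c. f (fst (fst z), snd (fst z), snd z)) \<in> borel_measurable lborel"
    by (simp add: borel_prod)
  have "(\<lambda>z. ennreal (norm (f z))) \<in> borel_measurable borel"
    using f by measurable
  from nn_integral_lborel_assoc[OF this] assms
  show "(\<integral>\<^sup>+z. ennreal (norm (f (fst (fst z), snd (fst z), snd z))) \<partial>lborel) < \<infinity>"
    by (simp add: integrable_iff_bounded)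
qed

section \<open>Integrability and $L^1$ distance on a set\<close>

text \<open>The model only makes functions measurable after multiplication by the indicator of their
  domain. Moving the indicator inside the absolute value makes the integrand a function of that
  product, to which the product-measure theorems apply.\<close>

lemma nn_set_integral_abs:
  "(\<integral>\<^sup>+z\<in>S. ennreal \<bar>F z\<bar> \<partial>lborel) = (\<integral>\<^sup>+z. ennreal \<bar>indicator S z * F z\<bar> \<partial>lborel)"
  by (intro nn_integral_cong) (auto simp: indicator_def)

lemma set_integrable_lborel_iff:
  fixes F :: "'a::euclidean_space \<Rightarrow> real"
  shows "set_integrable lborel S F \<longleftrightarrow>
    set_borel_measurable lborel S F \<and> (\<integral>\<^sup>+z\<in>S. ennreal \<bar>F z\<bar> \<partial>lborel) < \<infinity>"
  by (simp add: set_integrable_def set_borel_measurable_def integrable_iff_bounded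
      nn_set_integral_abs)

lemma L1_dist_triangle:
  assumes "set_borel_measurable lborel S F" "set_borel_measurable lborel S G"
    "set_borel_measurable lborel S H"
  shows "L1_dist S F H \<le> L1_dist S F G + L1_dist S G H"
proof -
  have m[measurable]: "(\<lambda>z. indicator S z * F z) \<in> borel_measurable borel"
    "(\<lambda>z. indicator S z * G z) \<in> borel_measurable borel"
    "(\<lambda>z. indicator S z * H z) \<in> borel_measurable borel"
    using assms by (auto simp: set_borel_measurable_def)
  have "L1_dist S F H \<le> (\<integral>\<^sup>+z. ennreal \<bar>indicator S z * F z - indicator S z * G z\<bar> +
      ennreal \<bar>indicator S z * G z - indicator S z * H z\<bar> \<partial>lborel)"
    unfolding L1_dist_def
    by (intro nn_integral_mono) (auto simp: indicator_def simp flip: ennreal_plus intro!: ennreal_leI)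
  also have "\<dots> = (\<integral>\<^sup>+z. ennreal \<bar>indicator S z * F z - indicator S z * G z\<bar> \<partial>lborel) +
      (\<integral>\<^sup>+z. ennreal \<bar>indicator S z * G z - indicator S z * H z\<bar> \<partial>lborel)"
    by (intro nn_integral_add) measurable
  also have "\<dots> = L1_dist S F G + L1_dist S G H"
    unfolding L1_dist_def nn_set_integral_abs by (simp add: right_diff_distrib)
  finally show ?thesis .
qed

section \<open>Marginalization as an $L^1$ contraction\<close>

text \<open>The indicator of the joint set splits into one of (x, \<theta>) and one of x'; the
  former is constant in x' and leaves the integral. The marginal thus becomes a section integral of
  one function on the whole space. Real factors leave a Bochner integral unconditionally, so this
  holds at every point.\<close>

lemma indicator_marginal:
  "indicator (state_set M \<times> param_set M) z * marginal M F z =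
    (\<integral>x'. indicator (joint_set M) (fst z, snd z, x') * F (fst z, snd z, x') \<partial>lborel)"
proof (cases z)
  case (Pair x \<theta>)
  have eq: "indicator (joint_set M) (x, \<theta>, x') * F (x, \<theta>, x') =
      indicator (state_set M \<times> param_set M) (x, \<theta>) *
        (indicator (state_set M) x' * F (x, \<theta>, x'))" for x'
    by (auto simp: joint_set_def indicator_def)
  show ?thesis
    unfolding Pair fst_conv snd_conv eq
    by (simp add: marginal_def set_lebesgue_integral_def)
qed

lemma set_integrable_marginal:
  fixes M :: "('x::euclidean_space, 'p::euclidean_space, 'o) ssm"
  assumes "set_integrable lborel (joint_set M) F"
  shows "set_integrable lborel (state_set M \<times> param_set M) (marginal M F)"
  using lborel_pair.integrable_fst'[of "\<lambda>z. indicator (joint_set M) (fst (fst z), snd (fst z), snd z) *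
      F (fst (fst z), snd (fst z), snd z)"]
    integrable_lborel_assoc[OF assms[unfolded set_integrable_def]]
  by (simp add: set_integrable_def indicator_marginal lborel_prod)

lemma L1_dist_marginal_le:
  fixes M :: "('x::euclidean_space, 'p::euclidean_space, 'o) ssm"
  assumes "set_integrable lborel (joint_set M) F" "set_integrable lborel (joint_set M) G"
  shows "L1_dist (state_set M \<times> param_set M) (marginal M F) (marginal M G)
    \<le> L1_dist (joint_set M) F G"
proof -
  define f where "f = (\<lambda>z. indicator (joint_set M) z * F z)"
  define g where "g = (\<lambda>z. indicator (joint_set M) z * G z)"
  have int: "integrable lborel f" "integrable lborel g"
    using assms by (auto simp: set_integrable_def f_def g_def)
  hence "integrable (lborel \<Otimes>\<^sub>M lborel) (\<lambda>z. f (fst (fst z), snd (fst z), snd z))"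
    "integrable (lborel \<Otimes>\<^sub>M lborel) (\<lambda>z. g (fst (fst z), snd (fst z), snd z))"
    unfolding lborel_prod by (auto intro: integrable_lborel_assoc)
  \<comment> \<open>Merging the two section integrals into the integral of the difference uses
    integrable sections, which Fubini supplies almost everywhere; hence the almost-everywhere
    comparison below.\<close>
  note sect = this[THEN lborel_pair.AE_integrable_fst']
  have fm: "f \<in> borel_measurable borel" "g \<in> borel_measurable borel"
    using int[THEN borel_measurable_integrable] by auto
  hence [measurable]: "f \<in> borel_measurable (borel \<Otimes>\<^sub>M borel \<Otimes>\<^sub>M borel)"
    "g \<in> borel_measurable (borel \<Otimes>\<^sub>M borel \<Otimes>\<^sub>M borel)"
    by (simp_all add: borel_prod)
  have m: "(\<lambda>z. ennreal \<bar>f z - g z\<bar>) \<in> borel_measurable borel"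
    using fm by measurable
  have "(\<lambda>z::('x \<times> 'p) \<times> 'x. ennreal \<bar>f (fst (fst z), snd (fst z), snd z) -
      g (fst (fst z), snd (fst z), snd z)\<bar>) \<in> borel_measurable ((borel \<Otimes>\<^sub>M borel) \<Otimes>\<^sub>M borel)"
    by measurable
  hence m': "(\<lambda>z::('x \<times> 'p) \<times> 'x. ennreal \<bar>f (fst (fst z), snd (fst z), snd z) -
      g (fst (fst z), snd (fst z), snd z)\<bar>) \<in> borel_measurable borel"
    by (simp add: borel_prod)
  have "L1_dist (state_set M \<times> param_set M) (marginal M F) (marginal M G) =
      (\<integral>\<^sup>+z. ennreal \<bar>(\<integral>x'. f (fst z, snd z, x') \<partial>lborel) - (\<integral>x'. g (fst z, snd z, x') \<partial>lborel)\<bar> \<partial>lborel)"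
    unfolding L1_dist_def nn_set_integral_abs right_diff_distrib indicator_marginal f_def g_def ..
  also have "\<dots> \<le> (\<integral>\<^sup>+z. \<integral>\<^sup>+x'. ennreal \<bar>f (fst z, snd z, x') - g (fst z, snd z, x')\<bar> \<partial>lborel \<partial>lborel)"
  proof (intro nn_integral_mono_AE, use sect in eventually_elim)
    case (elim z)
    hence "\<bar>(\<integral>x'. f (fst z, snd z, x') \<partial>lborel) - (\<integral>x'. g (fst z, snd z, x') \<partial>lborel)\<bar> =
        norm (\<integral>x'. f (fst z, snd z, x') - g (fst z, snd z, x') \<partial>lborel)"
      by simp
    with elim show ?case
      using integral_norm_bound_ennreal[of lborel "\<lambda>x'. f (fst z, snd z, x') - g (fst z, snd z, x')"]
      by simp
  qed
  also have "\<dots> = (\<integral>\<^sup>+z. ennreal \<bar>f z - g z\<bar> \<partial>lborel)"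
    using nn_integral_lborel_assoc[OF m] nn_integral_lborel_fst[OF m'] by simp
  also have "\<dots> = L1_dist (joint_set M) F G"
    unfolding L1_dist_def nn_set_integral_abs right_diff_distrib f_def g_def ..
  finally show ?thesis .
qed

section \<open>Integrability of the prior\<close>

text \<open>The prior has total mass 1: for fixed \<theta> the initial density integrates to 1 over
  x, and the parameter prior then integrates to 1 over \<theta>. This starts the integrability
  induction for the marginals.\<close>

lemma set_integrable_prior:
  assumes model: "state_space_model M"
  shows "set_integrable lborel (state_set M \<times> param_set M) (prior M)"
  unfolding set_integrable_lborel_iff
proof
  define p where "p = (\<lambda>\<theta>. indicator (param_set M) \<theta> * param_prior M \<theta>)"
  define q where "q = (\<lambda>z. indicator (state_set M \<times> param_set M) z * (\<lambda>(x, \<theta>). init_dens M x \<theta>) z)"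
  have [measurable]: "p \<in> borel_measurable borel"
    and qm: "q \<in> borel_measurable borel"
    using model by (auto simp: state_space_model_def prob_density_on_def set_borel_measurable_def p_def q_def)
  hence [measurable]: "q \<in> borel_measurable (borel \<Otimes>\<^sub>M borel)"
    by (simp add: borel_prod)
  have eq: "indicator (state_set M \<times> param_set M) z * prior M z = p (snd z) * q z" for z
    by (auto simp: p_def q_def prior_def indicator_def split: prod.splits)
  have "(\<lambda>z. p (snd z) * q z) \<in> borel_measurable (borel \<Otimes>\<^sub>M borel)"
    by measurable
  hence m: "(\<lambda>z. p (snd z) * q z) \<in> borel_measurable borel"
    by (simp add: borel_prod)
  thus "set_borel_measurable lborel (state_set M \<times> param_set M) (prior M)"
    by (simp add: set_borel_measurable_def eq)
  have p: "(\<integral>\<^sup>+\<theta>. ennreal \<bar>p \<theta>\<bar> \<partial>lborel) = 1"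
  proof -
    have "(\<integral>\<^sup>+\<theta>. ennreal \<bar>p \<theta>\<bar> \<partial>lborel) = (\<integral>\<^sup>+\<theta>\<in>param_set M. ennreal (param_prior M \<theta>) \<partial>lborel)"
      using model unfolding state_space_model_def prob_density_on_def
      by (intro nn_integral_cong) (auto simp: p_def indicator_def)
    thus ?thesis
      using model by (simp add: state_space_model_def prob_density_on_def)
  qed
  have q: "(\<integral>\<^sup>+x. ennreal \<bar>q (x, \<theta>)\<bar> \<partial>lborel) = 1" if "\<theta> \<in> param_set M" for \<theta>
  proof -
    have "(\<integral>\<^sup>+x. ennreal \<bar>q (x, \<theta>)\<bar> \<partial>lborel) = (\<integral>\<^sup>+x\<in>state_set M. ennreal (init_dens M x \<theta>) \<partial>lborel)"
      using model that unfolding state_space_model_def prob_density_on_def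
      by (intro nn_integral_cong) (auto simp: q_def indicator_def)
    thus ?thesis
      using model that by (simp add: state_space_model_def prob_density_on_def)
  qed
  have "(\<integral>\<^sup>+z\<in>state_set M \<times> param_set M. ennreal \<bar>prior M z\<bar> \<partial>lborel) =
      (\<integral>\<^sup>+\<theta>. \<integral>\<^sup>+x. ennreal \<bar>p \<theta> * q (x, \<theta>)\<bar> \<partial>lborel \<partial>lborel)"
    unfolding nn_set_integral_abs eq using m by (subst nn_integral_lborel_snd) auto
  also have "\<dots> = (\<integral>\<^sup>+\<theta>. ennreal \<bar>p \<theta>\<bar> * (\<integral>\<^sup>+x. ennreal \<bar>q (x, \<theta>)\<bar> \<partial>lborel) \<partial>lborel)"
    by (simp add: abs_mult ennreal_mult nn_integral_cmult)
  \<comment> \<open>Off the parameter set \<open>p\<close> is zero, so the unit mass of the sections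
    of \<open>q\<close> is needed only for \<theta> in that set.\<close>
  also have "\<dots> = (\<integral>\<^sup>+\<theta>. ennreal \<bar>p \<theta>\<bar> \<partial>lborel)"
    by (intro nn_integral_cong) (use q in \<open>auto simp: p_def indicator_def\<close>)
  finally show "(\<integral>\<^sup>+z\<in>state_set M \<times> param_set M. ennreal \<bar>prior M z\<bar> \<partial>lborel) < \<infinity>"
    using p by simp
qed

section \<open>The propagation step\<close>

context
  fixes M :: "(real ^ 'm, real ^ 'd, real ^ 'n) ssm" and y :: "real ^ 'n"
    and \<mu> :: "(real ^ 'm) \<times> (real ^ 'd) \<Rightarrow> real"
  assumes model: "state_space_model M" and y: "y \<in> data_set M"
    and \<mu>: "set_borel_measurable lborel (state_set M \<times> param_set M) \<mu>"
begin

lemma indicator_propagate_borel: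
  "(\<lambda>z. indicator (joint_set M) z * propagate M y \<mu> z) \<in> borel_measurable borel"
proof -
  define u where "u = (\<lambda>z. indicator (state_set M \<times> param_set M) z * \<mu> z)"
  define l where "l = (\<lambda>z. indicator (state_set M \<times> param_set M) z * (\<lambda>(x, \<theta>). likelihood M y x \<theta>) z)"
  define f where "f = (\<lambda>z. indicator (state_set M \<times> state_set M \<times> param_set M) z *
    (\<lambda>(x, x', \<theta>). trans_dens M x x' \<theta>) z)"
  have "u \<in> borel_measurable borel" "l \<in> borel_measurable borel" "f \<in> borel_measurable borel"
    using model y \<mu> by (auto simp: state_space_model_def set_borel_measurable_def u_def l_def f_def)
  hence [measurable]: "u \<in> borel_measurable (borel \<Otimes>\<^sub>M borel)" "l \<in> borel_measurable (borel \<Otimes>\<^sub>M borel)"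
    "f \<in> borel_measurable (borel \<Otimes>\<^sub>M borel \<Otimes>\<^sub>M borel)"
    by (simp_all add: borel_prod)
  \<comment> \<open>The three zero-extended factors together carry exactly the indicator of the
    joint set. The coordinates are permuted because \<open>trans_dens\<close> takes (x, x',
    \<theta>) and \<mu> takes (x', \<theta>).\<close>
  have "indicator (joint_set M) z * propagate M y \<mu> z =
      u (snd (snd z), fst (snd z)) * f (fst z, snd (snd z), fst (snd z)) * l (fst z, fst (snd z))" for z
    by (auto simp: u_def f_def l_def joint_set_def propagate_def indicator_def split: prod.splits)
  moreover have "(\<lambda>z. u (snd (snd z), fst (snd z)) * f (fst z, snd (snd z), fst (snd z)) *
      l (fst z, fst (snd z))) \<in> borel_measurable (borel \<Otimes>\<^sub>M borel \<Otimes>\<^sub>M borel)"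
    by measurable
  ultimately show ?thesis
    by (simp add: borel_prod)
qed

text \<open>Only the factors f and g depend on x, and they are nonnegative, so integrating over x
  first leaves |\<mu>| times an integral bounded by \<open>C\<close>. No sign condition is put on
  \<mu>, so that a difference of marginals may be inserted. Leaving \<open>C\<close> abstract serves
  both choices of the constant.\<close>

lemma nn_integral_propagate_le:
  assumes C: "\<And>x' \<theta>. x' \<in> state_set M \<Longrightarrow> \<theta> \<in> param_set M \<Longrightarrow>
    (\<integral>\<^sup>+x\<in>state_set M. ennreal (trans_dens M x x' \<theta> * likelihood M y x \<theta>) \<partial>lborel) \<le> C"
  shows "(\<integral>\<^sup>+z\<in>joint_set M. ennreal \<bar>propagate M y \<mu> z\<bar> \<partial>lborel)
    \<le> C * (\<integral>\<^sup>+z\<in>state_set M \<times> param_set M. ennreal \<bar>\<mu> z\<bar> \<partial>lborel)"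
proof -
  define S where "S = state_set M"
  define P where "P = param_set M"
  define u where "u = (\<lambda>z. indicator (S \<times> P) z * \<mu> z)"
  define h where "h = (\<lambda>z. ennreal \<bar>indicator (joint_set M) z * propagate M y \<mu> z\<bar>)"
  have um: "u \<in> borel_measurable borel"
    using \<mu> by (simp add: set_borel_measurable_def u_def S_def P_def)
  hence [measurable]: "u \<in> borel_measurable (borel \<Otimes>\<^sub>M borel)"
    by (simp add: borel_prod)
  have hm: "h \<in> borel_measurable borel"
    unfolding h_def using indicator_propagate_borel by measurable
  hence [measurable]: "h \<in> borel_measurable (borel \<Otimes>\<^sub>M borel \<Otimes>\<^sub>M borel)"
    by (simp add: borel_prod)
  have "(\<lambda>w. \<integral>\<^sup>+x. h (x, w) \<partial>lborel) \<in> borel_measurable (borel \<Otimes>\<^sub>M borel)"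
    by measurable
  hence hm': "(\<lambda>w. \<integral>\<^sup>+x. h (x, w) \<partial>lborel) \<in> borel_measurable borel"
    by (simp add: borel_prod)
  have nonneg: "0 \<le> trans_dens M x x' \<theta>" "0 \<le> likelihood M y x \<theta>"
    if "x \<in> S" "x' \<in> S" "\<theta> \<in> P" for x x' \<theta>
    using model y that by (auto simp: state_space_model_def prob_density_on_def S_def P_def)
  have le: "(\<integral>\<^sup>+x. h (x, \<theta>, x') \<partial>lborel) \<le> C * ennreal \<bar>u (x', \<theta>)\<bar>" for \<theta> x'
  proof (cases "x' \<in> S \<and> \<theta> \<in> P")
    case True
    define k where "k = (\<lambda>x. ennreal (trans_dens M x x' \<theta> * likelihood M y x \<theta>) * indicator S x)"
    have km: "k \<in> borel_measurable lborel"
    proof -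
      \<comment> \<open>The model gives the likelihood joint measurability in (x, \<theta>) only;
        its section at fixed \<theta> is taken from the zero extension.\<close>
      define l where "l = (\<lambda>z. indicator (S \<times> P) z * (\<lambda>(x, \<theta>). likelihood M y x \<theta>) z)"
      define f where "f = (\<lambda>x. indicator S x * trans_dens M x x' \<theta>)"
      have [measurable]: "f \<in> borel_measurable borel" and "l \<in> borel_measurable borel"
        using model y True
        by (auto simp: state_space_model_def prob_density_on_def set_borel_measurable_def S_def P_def
            f_def l_def)
      hence [measurable]: "l \<in> borel_measurable (borel \<Otimes>\<^sub>M borel)"
        by (simp add: borel_prod)
      have "k = (\<lambda>x. ennreal (f x * l (x, \<theta>)))"
        using True by (auto simp: k_def f_def l_def indicator_def)
      thus ?thesis
        by simp
    qed
    have "(\<integral>\<^sup>+x. h (x, \<theta>, x') \<partial>lborel) = (\<integral>\<^sup>+x. ennreal \<bar>\<mu> (x', \<theta>)\<bar> * k x \<partial>lborel)"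
      using True nonneg
      by (intro nn_integral_cong)
        (auto simp: h_def k_def joint_set_def propagate_def indicator_def S_def P_def abs_mult
          mult.assoc ennreal_mult)
    also have "\<dots> = ennreal \<bar>\<mu> (x', \<theta>)\<bar> * (\<integral>\<^sup>+x. k x \<partial>lborel)"
      by (rule nn_integral_cmult[OF km])
    also have "\<dots> \<le> ennreal \<bar>\<mu> (x', \<theta>)\<bar> * C"
      using C[of x' \<theta>] True by (intro mult_left_mono) (auto simp: k_def S_def P_def)
    finally show ?thesis
      using True by (simp add: u_def mult.commute)
  next
    case False
    thus ?thesis
      by (auto simp: h_def joint_set_def indicator_def S_def P_def)
  qed
  have "(\<integral>\<^sup>+z\<in>joint_set M. ennreal \<bar>propagate M y \<mu> z\<bar> \<partial>lborel) = (\<integral>\<^sup>+z. h z \<partial>lborel)"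
    by (simp add: nn_set_integral_abs h_def)
  \<comment> \<open>With x innermost, the order of the two outer integrals is chosen to match the
    unfolding of \<open>u\<close>, whose arguments are (x', \<theta>), below.\<close>
  also have "\<dots> = (\<integral>\<^sup>+\<theta>. \<integral>\<^sup>+x'. \<integral>\<^sup>+x. h (x, \<theta>, x') \<partial>lborel \<partial>lborel \<partial>lborel)"
    by (simp add: nn_integral_lborel_snd[OF hm] nn_integral_lborel_fst[OF hm'])
  also have "\<dots> \<le> (\<integral>\<^sup>+\<theta>. \<integral>\<^sup>+x'. C * ennreal \<bar>u (x', \<theta>)\<bar> \<partial>lborel \<partial>lborel)"
    by (intro nn_integral_mono le)
  also have "\<dots> = C * (\<integral>\<^sup>+\<theta>. \<integral>\<^sup>+x'. ennreal \<bar>u (x', \<theta>)\<bar> \<partial>lborel \<partial>lborel)"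
    by (simp add: nn_integral_cmult)
  also have "(\<integral>\<^sup>+\<theta>. \<integral>\<^sup>+x'. ennreal \<bar>u (x', \<theta>)\<bar> \<partial>lborel \<partial>lborel) = (\<integral>\<^sup>+z. ennreal \<bar>u z\<bar> \<partial>lborel)"
    using um by (subst nn_integral_lborel_snd) auto
  finally show ?thesis
    by (simp add: nn_set_integral_abs u_def S_def P_def)
qed

end

text \<open>Finiteness of the constant enters here: it keeps the mass finite, so that the recursion
  never leaves the integrable functions.\<close>

lemma set_integrable_propagate:
  fixes M :: "(real ^ 'm, real ^ 'd, real ^ 'n) ssm"
  assumes model: "state_space_model M" and y: "y \<in> data_set M"
    and \<mu>: "set_integrable lborel (state_set M \<times> param_set M) \<mu>"
    and C: "\<And>x' \<theta>. x' \<in> state_set M \<Longrightarrow> \<theta> \<in> param_set M \<Longrightarrow>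
      (\<integral>\<^sup>+x\<in>state_set M. ennreal (trans_dens M x x' \<theta> * likelihood M y x \<theta>) \<partial>lborel) \<le> C"
    and "C < \<infinity>"
  shows "set_integrable lborel (joint_set M) (propagate M y \<mu>)"
proof -
  have \<mu>': "set_borel_measurable lborel (state_set M \<times> param_set M) \<mu>"
    "(\<integral>\<^sup>+z\<in>state_set M \<times> param_set M. ennreal \<bar>\<mu> z\<bar> \<partial>lborel) < \<infinity>"
    using \<mu> by (auto simp: set_integrable_lborel_iff)
  note nn_integral_propagate_le[OF model y \<mu>'(1) C]
  also have "C * (\<integral>\<^sup>+z\<in>state_set M \<times> param_set M. ennreal \<bar>\<mu> z\<bar> \<partial>lborel) < \<infinity>"
    using \<mu>'(2) \<open>C < \<infinity>\<close> by (simp add: ennreal_mult_less_top)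
  finally show ?thesis
    using indicator_propagate_borel[OF model y \<mu>'(1)]
    by (simp add: set_integrable_lborel_iff set_borel_measurable_def)
qed

lemma L1_dist_propagate_le:
  fixes M :: "(real ^ 'm, real ^ 'd, real ^ 'n) ssm"
  assumes model: "state_space_model M" and y: "y \<in> data_set M"
    and \<mu>: "set_borel_measurable lborel (state_set M \<times> param_set M) \<mu>"
    and \<nu>: "set_borel_measurable lborel (state_set M \<times> param_set M) \<nu>"
    and C: "\<And>x' \<theta>. x' \<in> state_set M \<Longrightarrow> \<theta> \<in> param_set M \<Longrightarrow>
      (\<integral>\<^sup>+x\<in>state_set M. ennreal (trans_dens M x x' \<theta> * likelihood M y x \<theta>) \<partial>lborel) \<le> C"
  shows "L1_dist (joint_set M) (propagate M y \<mu>) (propagate M y \<nu>)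
    \<le> C * L1_dist (state_set M \<times> param_set M) \<mu> \<nu>"
proof -
  have "set_borel_measurable lborel (state_set M \<times> param_set M) (\<lambda>z. \<mu> z - \<nu> z)"
    using \<mu> \<nu> by (simp add: set_borel_measurable_def right_diff_distrib)
  from nn_integral_propagate_le[OF model y this C]
  have "(\<integral>\<^sup>+z\<in>joint_set M. ennreal \<bar>propagate M y (\<lambda>z. \<mu> z - \<nu> z) z\<bar> \<partial>lborel)
    \<le> C * L1_dist (state_set M \<times> param_set M) \<mu> \<nu>"
    by (simp add: L1_dist_def)
  \<comment> \<open>Linearity of \<open>propagate\<close> in the marginal reduces the distance to
    the mass bound for the signed function \<mu> - \<nu>.\<close>
  also have "propagate M y (\<lambda>z. \<mu> z - \<nu> z) = (\<lambda>z. propagate M y \<mu> z - propagate M y \<nu> z)"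
    by (auto simp: propagate_def algebra_simps)
  finally show ?thesis
    by (simp add: L1_dist_def)
qed

section \<open>The two constants as bounds on the same integral\<close>

lemma nn_integral_trans_likelihood_le_Cf:
  assumes "x' \<in> state_set M" "\<theta> \<in> param_set M"
  shows "(\<integral>\<^sup>+x\<in>state_set M. ennreal (trans_dens M x x' \<theta> * likelihood M (y t) x \<theta>) \<partial>lborel) \<le> Cf M y t"
  unfolding Cf_def by (rule SUP_upper2[of "(x', \<theta>)"]) (use assms in auto)

text \<open>The likelihood is replaced by its supremum, which factors out, and the remaining
  transition density integrates to one.\<close>

lemma nn_integral_trans_likelihood_le_Cg:
  assumes model: "state_space_model M" and "x' \<in> state_set M" "\<theta> \<in> param_set M"
  shows "(\<integral>\<^sup>+x\<in>state_set M. ennreal (trans_dens M x x' \<theta> * likelihood M (y t) x \<theta>) \<partial>lborel) \<le> Cg M y t"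
proof -
  have "prob_density_on (state_set M) (\<lambda>x. trans_dens M x x' \<theta>)"
    using assms by (simp add: state_space_model_def)
  hence m: "(\<lambda>x. indicator (state_set M) x * trans_dens M x x' \<theta>) \<in> borel_measurable borel"
    and nonneg: "\<And>x. x \<in> state_set M \<Longrightarrow> 0 \<le> trans_dens M x x' \<theta>"
    and one: "(\<integral>\<^sup>+x\<in>state_set M. ennreal (trans_dens M x x' \<theta>) \<partial>lborel) = 1"
    by (auto simp: prob_density_on_def set_borel_measurable_def)
  have eq: "ennreal (trans_dens M x x' \<theta>) * indicator (state_set M) x =
      ennreal (indicator (state_set M) x * trans_dens M x x' \<theta>)" for x
    by (auto simp: indicator_def)
  have "ennreal (likelihood M (y t) x \<theta>) \<le> Cg M y t" if "x \<in> state_set M" for x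
    unfolding Cg_def by (rule SUP_upper2[of "(x, \<theta>)"]) (use assms that in auto)
  hence "(\<integral>\<^sup>+x\<in>state_set M. ennreal (trans_dens M x x' \<theta> * likelihood M (y t) x \<theta>) \<partial>lborel)
      \<le> (\<integral>\<^sup>+x. (ennreal (trans_dens M x x' \<theta>) * indicator (state_set M) x) * Cg M y t \<partial>lborel)"
    using nonneg
    by (intro nn_integral_mono) (auto simp: indicator_def ennreal_mult' intro!: mult_left_mono)
  also have "\<dots> = Cg M y t"
    using m one unfolding eq by (subst nn_integral_multc) auto
  finally show ?thesis .
qed

section \<open>Iterating the one-step error bound\<close>

text \<open>A discrete Gronwall argument. The conclusion bounds the right-hand side of the recursion
  rather than \<open>E (Suc t)\<close>, because the second inequality of the theorem concerns that
  middle term. Working in \<open>ennreal\<close> allows \<open>C\<close> to be infinite.\<close>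

lemma geometric_sum_bound_ennreal:
  fixes E e :: "nat \<Rightarrow> ennreal"
  assumes "E 0 = 0" and E: "\<And>t. E (Suc t) \<le> c (Suc t) * E t + e (Suc t)"
    and c: "\<And>t. c (Suc t) \<le> C"
  shows "c (Suc t) * E t + e (Suc t) \<le> (\<Sum>k=1..Suc t. C ^ (Suc t - k) * e k)"
proof -
  \<comment> \<open>Used twice: composed with the recursion it is the induction step, and alone it
    is the conclusion.\<close>
  have step: "c (Suc t) * E t + e (Suc t) \<le> (\<Sum>k=1..Suc t. C ^ (Suc t - k) * e k)"
    if "E t \<le> (\<Sum>k=1..t. C ^ (t - k) * e k)" for t
  proof -
    have "c (Suc t) * E t + e (Suc t) \<le> C * (\<Sum>k=1..t. C ^ (t - k) * e k) + e (Suc t)"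
      by (intro add_right_mono mult_mono c that) auto
    \<comment> \<open>Multiplying by \<open>C\<close> raises each exponent by one, as k \<le> t. The
      term left over is the summand k = \<open>Suc t\<close>, with exponent 0.\<close>
    also have "C * (\<Sum>k=1..t. C ^ (t - k) * e k) = (\<Sum>k=1..t. C ^ (Suc t - k) * e k)"
      unfolding sum_distrib_left
      by (intro sum.cong) (auto simp: Suc_diff_le mult.assoc)
    finally show ?thesis
      by simp
  qed
  have "E t \<le> (\<Sum>k=1..t. C ^ (t - k) * e k)" for t
  proof (induction t)
    case 0
    thus ?case using assms(1) by simp
  next
    case (Suc t)
    show ?case
      using order_trans[OF E step[OF Suc.IH]] .
  qed
  thus ?thesis
    by (rule step)
qed

theorem theorem7:
  fixes M :: "(real ^ 'm::{finite,wellorder}, real ^ 'd::{finite,wellorder}, real ^ 'n::finite) ssm"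
    and y :: "nat \<Rightarrow> real ^ 'n::finite"
    and \<pi>hat :: "nat \<Rightarrow> (real ^ 'm::{finite,wellorder}) \<times> (real ^ 'd::{finite,wellorder}) \<times> (real ^ 'm::{finite,wellorder}) \<Rightarrow> real"
    and \<epsilon> :: "nat \<Rightarrow> real"
    and Ch :: "nat \<Rightarrow> ennreal"
  assumes model: "state_space_model M"
    and data: "\<And>t. t \<ge> 1 \<Longrightarrow> y t \<in> data_set M"
    and h: "Ch = Cf M y \<or> Ch = Cg M y"
    and Ch_finite: "\<And>t. t \<ge> 1 \<Longrightarrow> Ch t < \<infinity>"
    and \<pi>hat_integrable: "\<And>t. t \<ge> 1 \<Longrightarrow> set_integrable lborel (joint_set M) (\<pi>hat t)"
    and \<pi>hat_tensor_train: "\<And>t. t \<ge> 1 \<Longrightarrow> tensor_train_on (joint_set M) (\<pi>hat t)"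
    and \<epsilon>_nonneg: "\<And>t. t \<ge> 1 \<Longrightarrow> 0 \<le> \<epsilon> t"
    and step_error: "\<And>t. t \<ge> 1 \<Longrightarrow>
          L1_dist (joint_set M) (\<pi>hat t) (approx_target M y \<pi>hat t) \<le> ennreal (\<epsilon> t)"
  shows "\<forall>t>0.
    total_error M y \<pi>hat t \<le> Ch t * total_error M y \<pi>hat (t - 1) + ennreal (\<epsilon> t) \<and>
    Ch t * total_error M y \<pi>hat (t - 1) + ennreal (\<epsilon> t)
      \<le> (\<Sum>k=1..t. (SUP s\<in>{1..}. Ch s) ^ (t - k) * ennreal (\<epsilon> k))"
proof (intro allI impI)
  \<comment> \<open>From here on the two choices of the constant are treated alike: only this
    integral bound is used.\<close>
  have C: "(\<integral>\<^sup>+x\<in>state_set M. ennreal (trans_dens M x x' \<theta> * likelihood M (y t) x \<theta>) \<partial>lborel) \<le> Ch t"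
    if "x' \<in> state_set M" "\<theta> \<in> param_set M" for x' \<theta> t
    using h nn_integral_trans_likelihood_le_Cf[OF that]
      nn_integral_trans_likelihood_le_Cg[OF model that] by auto
  have exact: "set_integrable lborel (state_set M \<times> param_set M) (exact_marginal M y t)" for t
  proof (induction t)
    case 0
    thus ?case
      using set_integrable_prior[OF model] by simp
  next
    case (Suc t)
    thus ?case
      using set_integrable_marginal[OF set_integrable_propagate[OF model data Suc.IH C Ch_finite]]
      by simp
  qed
  have exact_post: "set_integrable lborel (joint_set M) (exact_post M y (Suc t))" for t
    unfolding exact_post_def by (rule set_integrable_propagate[OF model data exact C Ch_finite]) auto
  have approx: "set_integrable lborel (state_set M \<times> param_set M) (approx_marginal M \<pi>hat t)" for t
    using set_integrable_prior[OF model] set_integrable_marginal[OF \<pi>hat_integrable]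
    by (simp add: approx_marginal_def)
  \<comment> \<open>At time 0 \<open>total_error\<close> is itself the distance of the marginals; at
    later times the contraction applies.\<close>
  have marg: "L1_dist (state_set M \<times> param_set M) (approx_marginal M \<pi>hat t) (exact_marginal M y t)
      \<le> total_error M y \<pi>hat t" for t
  proof (cases t)
    case (Suc s)
    thus ?thesis
      using L1_dist_marginal_le[OF \<pi>hat_integrable exact_post[of s]]
      by (simp add: total_error_def approx_marginal_def exact_post_def)
  qed (simp add: total_error_def)
  have meas: "set_borel_measurable lborel S F" if "set_integrable lborel S F"
    for S and F :: "'z::euclidean_space \<Rightarrow> real"
    using that by (simp add: set_integrable_lborel_iff)
  have step: "total_error M y \<pi>hat (Suc t) \<le> Ch (Suc t) * total_error M y \<pi>hat t + ennreal (\<epsilon> (Suc t))" for t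
  proof -
    have target: "set_integrable lborel (joint_set M) (approx_target M y \<pi>hat (Suc t))"
      unfolding approx_target_def
      by (rule set_integrable_propagate[OF model data approx C Ch_finite]) auto
    have "total_error M y \<pi>hat (Suc t)
        \<le> L1_dist (joint_set M) (\<pi>hat (Suc t)) (approx_target M y \<pi>hat (Suc t)) +
          L1_dist (joint_set M) (approx_target M y \<pi>hat (Suc t)) (exact_post M y (Suc t))"
      using L1_dist_triangle[OF \<pi>hat_integrable[THEN meas] target[THEN meas] exact_post[THEN meas]]
      by (simp add: total_error_def)
    also have "\<dots> \<le> ennreal (\<epsilon> (Suc t)) + Ch (Suc t) *
        L1_dist (state_set M \<times> param_set M) (approx_marginal M \<pi>hat t) (exact_marginal M y t)"
      unfolding approx_target_def exact_post_def
      using step_error[of "Suc t"]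
        L1_dist_propagate_le[OF model data[of "Suc t"] approx[THEN meas] exact[THEN meas] C, of t t]
      by (intro add_mono) (auto simp: approx_target_def)
    also have "\<dots> \<le> ennreal (\<epsilon> (Suc t)) + Ch (Suc t) * total_error M y \<pi>hat t"
      by (intro add_left_mono mult_left_mono marg) simp
    finally show ?thesis
      by (simp add: add.commute)
  qed
  fix t :: nat
  assume "t > 0"
  then obtain s where t: "t = Suc s"
    using gr0_implies_Suc by blast
  \<comment> \<open>Both time-0 marginals are the prior, so the iteration starts from zero.\<close>
  have "total_error M y \<pi>hat 0 = 0"
    by (simp add: total_error_def approx_marginal_def L1_dist_def)
  \<comment> \<open>The recursion uses the constants at successor times only, which matches the
    supremum over times from 1 on. That supremum may be infinite although each constant is
    finite.\<close>
  from geometric_sum_bound_ennreal[of "total_error M y \<pi>hat" Ch "\<lambda>t. ennreal (\<epsilon> t)", OF this step,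
      of "SUP s\<in>{1..}. Ch s" s] step[of s]
  show "total_error M y \<pi>hat t \<le> Ch t * total_error M y \<pi>hat (t - 1) + ennreal (\<epsilon> t) \<and>
    Ch t * total_error M y \<pi>hat (t - 1) + ennreal (\<epsilon> t)
      \<le> (\<Sum>k=1..t. (SUP s\<in>{1..}. Ch s) ^ (t - k) * ennreal (\<epsilon> k))"
    by (simp add: t SUP_upper)
qed

end
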